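(* The two rings $\mathbb{Z}[\sqrt{-3}]$ and $\mathbb{Z}[\sqrt{-7}]$ are projective-free.
   Context: An integral domain $R$ is projective-free if every finitely generated projective $R$-module is free. *)

theory Defs
  imports
    "HOL-Algebra.Algebraic_Closure_Type"
    "HOL-Algebra.Generated_Rings"
    "Jordan_Normal_Form.Missing_VectorSpace"
begin

definition fin_gen_module :: "('a, 'r) ring_scheme \<Rightarrow> ('a, 'm, 'k) module_scheme \<Rightarrow> bool" where
  "fin_gen_module R M \<longleftrightarrow>
     module R M \<and> (\<exists>S. finite S \<and> S \<subseteq> carrier M \<and> module.gen_set R M S)"

definition free_module :: "('a, 'r) ring_scheme \<Rightarrow> ('a, 'm, 'k) module_scheme \<Rightarrow> bool" where
  "free_module R M \<longleftrightarrow>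
     module R M \<and>
     (\<exists>B. B \<subseteq> carrier M \<and> module.gen_set R M B \<and> \<not> module.lin_dep R M B)"

text \<open>
  Projectivity is the lifting property against surjections \<open>g : M \<rightarrow> N\<close>. A definition in HOL
  cannot quantify over the types carrying \<open>M\<close> and \<open>N\<close>. The types chosen below are large enough:
  the free module on the elements of \<open>P\<close> lives in \<^typ>\<open>'p \<Rightarrow> 'a\<close>, so lifting the identity of \<open>P\<close>
  along its canonical surjection onto \<open>P\<close> gives liftings against modules on arbitrary types;
  see \<open>projective_module_lift\<close> below.
\<close>

definition projective_module :: "('a, 'r) ring_scheme \<Rightarrow> ('a, 'p, 'k) module_scheme \<Rightarrow> bool" where
  "projective_module R P \<longleftrightarrow>
     module R P \<and>
     (\<forall>(M :: ('a, 'p \<Rightarrow> 'a) module) (N :: ('a, 'p) module) g f.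
        module R M \<and> module R N \<and>
        g \<in> module_hom R M N \<and> g ` carrier M = carrier N \<and> f \<in> module_hom R P N
        \<longrightarrow> (\<exists>h \<in> module_hom R P M. \<forall>x \<in> carrier P. g (h x) = f x))"

text \<open>
  The type argument is the type carrying the modules; a statement
  \<open>projective_free TYPE('m) R\<close> with \<^typ>\<open>'m\<close> a type variable is about all modules.
\<close>

definition projective_free :: "'m itself \<Rightarrow> ('a, 'r) ring_scheme \<Rightarrow> bool" where
  "projective_free (_ :: 'm itself) R \<longleftrightarrow>
     domain R \<and>
     (\<forall>M :: ('a, 'm) module.
        fin_gen_module R M \<and> projective_module R M \<longrightarrow> free_module R M)"

definition int_adjoin :: "complex \<Rightarrow> complex ring" (\<open>\<int>[_]\<close>) where
  "\<int>[\<alpha>] = ring_of_type_algebra \<lparr>carrier := generate_ring ring_of_type_algebra {\<alpha>}\<rparr>"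

lemma carrier_int_adjoin_csqrt:
  "carrier \<int>[csqrt (of_int d)] = {of_int a + of_int b * csqrt (of_int d) | a b. True}"
    (is "_ = ?Z")
proof
  define C where "C = (ring_of_type_algebra :: complex ring)"
  interpret ring C unfolding C_def by (rule ring_from_type_algebra)
  have C [simp]: "carrier C = UNIV" "x \<oplus>\<^bsub>C\<^esub> y = x + y" "x \<otimes>\<^bsub>C\<^esub> y = x * y"
    "\<one>\<^bsub>C\<^esub> = 1" "\<zero>\<^bsub>C\<^esub> = 0" for x y
    by (simp_all add: C_def ring_of_type_algebra_def)
  have inv [simp]: "\<ominus>\<^bsub>C\<^esub> x = - x" for x
    using minus_equality[of "- x" x] by simp
  let ?G = "generate_ring C {csqrt (of_int d)}"
  have carr: "carrier \<int>[csqrt (of_int d)] = ?G"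
    by (simp add: int_adjoin_def C_def)
  show "carrier \<int>[csqrt (of_int d)] \<subseteq> ?Z"
  proof
    fix x assume "x \<in> carrier \<int>[csqrt (of_int d)]"
    then have "x \<in> ?G" by (simp add: carr)
    then show "x \<in> ?Z"
    proof (induction rule: generate_ring.induct)
      case one
      show ?case by (auto intro: exI[of _ 1] exI[of _ 0])
    next
      case (incl h)
      then have "h = of_int 0 + of_int 1 * csqrt (of_int d)" by simp
      then show ?case by blast
    next
      case (a_inv h)
      then obtain a b where "h = of_int a + of_int b * csqrt (of_int d)" by blast
      then have "\<ominus>\<^bsub>C\<^esub> h = of_int (- a) + of_int (- b) * csqrt (of_int d)" by simp
      then show ?case by blast
    next
      case (eng_add x y)
      then obtain a b a' b' where "x = of_int a + of_int b * csqrt (of_int d)"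
        "y = of_int a' + of_int b' * csqrt (of_int d)" by blast
      then have "x \<oplus>\<^bsub>C\<^esub> y = of_int (a + a') + of_int (b + b') * csqrt (of_int d)"
        by (simp add: algebra_simps)
      then show ?case by blast
    next
      case (eng_mult x y)
      then obtain a b a' b' where xy: "x = of_int a + of_int b * csqrt (of_int d)"
        "y = of_int a' + of_int b' * csqrt (of_int d)" by blast
      have sq: "csqrt (of_int d) * csqrt (of_int d) = of_int d"
        by (metis power2_csqrt power2_eq_square)
      have "(p + q * c) * (p' + q' * c) = p * p' + q * q' * (c * c) + (p * q' + q * p') * c"
        for p q p' q' c :: complex
        by (simp add: algebra_simps)
      then have "x \<otimes>\<^bsub>C\<^esub> y =
          of_int (a * a' + b * b' * d) + of_int (a * b' + b * a') * csqrt (of_int d)"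
        unfolding xy C of_int_add of_int_mult by (simp only: sq)
      then show ?case by blast
    qed
  qed
  have nat: "of_nat n \<in> ?G" for n :: nat
  proof (induction n)
    case 0
    show ?case using zero_in_generate by simp
  next
    case (Suc n)
    then show ?case
      using generate_ring.eng_add[OF generate_ring.one[of C] Suc] by simp
  qed
  have int: "of_int n \<in> ?G" for n :: int
  proof (cases n)
    case (nonneg m)
    then show ?thesis using nat[of m] by simp
  next
    case (neg m)
    then show ?thesis using generate_ring.a_inv[OF nat[of "Suc m"]] by simp
  qed
  have gen: "csqrt (of_int d) \<in> ?G"
    by (simp add: generate_ring.incl)
  show "?Z \<subseteq> carrier \<int>[csqrt (of_int d)]"
    using generate_ring.eng_add[OF int generate_ring.eng_mult[OF int gen]] carr by auto
qed

definition finsupp_module ::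
  "('a, 'r) ring_scheme \<Rightarrow> 'p set \<Rightarrow> ('a, 'p \<Rightarrow> 'a) module" where
  "finsupp_module R S =
     \<lparr>carrier = {u. u \<in> S \<rightarrow> carrier R \<and> (\<forall>x. x \<notin> S \<longrightarrow> u x = \<zero>\<^bsub>R\<^esub>) \<and> finite {x. u x \<noteq> \<zero>\<^bsub>R\<^esub>}},
      monoid.mult = (\<lambda>u v x. \<zero>\<^bsub>R\<^esub>), one = (\<lambda>x. \<zero>\<^bsub>R\<^esub>), ring.zero = (\<lambda>x. \<zero>\<^bsub>R\<^esub>),
      add = (\<lambda>u v x. u x \<oplus>\<^bsub>R\<^esub> v x), module.smult = (\<lambda>c u x. c \<otimes>\<^bsub>R\<^esub> u x)\<rparr>"

lemma (in cring) finsupp_module: "module R (finsupp_module R S)"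
proof -
  let ?F = "finsupp_module R S"
  have mem: "u x \<in> carrier R" if "u \<in> carrier ?F" for u x
    using that by (cases "x \<in> S") (auto simp: finsupp_module_def)
  have add: "(\<lambda>x. u x \<oplus> v x) \<in> carrier ?F" if "u \<in> carrier ?F" "v \<in> carrier ?F" for u v
  proof -
    have "{x. u x \<oplus> v x \<noteq> \<zero>} \<subseteq> {x. u x \<noteq> \<zero>} \<union> {x. v x \<noteq> \<zero>}" by auto
    moreover have "finite ({x. u x \<noteq> \<zero>} \<union> {x. v x \<noteq> \<zero>})"
      using that by (auto simp: finsupp_module_def)
    ultimately have "finite {x. u x \<oplus> v x \<noteq> \<zero>}" by (rule finite_subset)
    with that show ?thesis by (auto simp: finsupp_module_def)
  qed
  have smult: "(\<lambda>x. c \<otimes> u x) \<in> carrier ?F" if "u \<in> carrier ?F" "c \<in> carrier R" for u c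
  proof -
    have "{x. c \<otimes> u x \<noteq> \<zero>} \<subseteq> {x. u x \<noteq> \<zero>}" using that by auto
    then have "finite {x. c \<otimes> u x \<noteq> \<zero>}"
      by (rule finite_subset) (use that in \<open>auto simp: finsupp_module_def\<close>)
    with that show ?thesis by (auto simp: finsupp_module_def)
  qed
  have ops [simp]: "\<zero>\<^bsub>?F\<^esub> = (\<lambda>x. \<zero>)" "u \<oplus>\<^bsub>?F\<^esub> v = (\<lambda>x. u x \<oplus> v x)"
    "c \<odot>\<^bsub>?F\<^esub> u = (\<lambda>x. c \<otimes> u x)" for u v c
    by (simp_all add: finsupp_module_def)
  show ?thesis
  proof (rule moduleI)
    show "cring R" by (rule is_cring)
    show "abelian_group ?F"
    proof (rule abelian_groupI)
      show "\<zero>\<^bsub>?F\<^esub> \<in> carrier ?F" by (auto simp: finsupp_module_def)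
      fix u assume u: "u \<in> carrier ?F"
      have "(\<lambda>x. \<ominus> \<one> \<otimes> u x) \<in> carrier ?F" using smult[OF u, of "\<ominus> \<one>"] by simp
      moreover have "(\<lambda>x. \<ominus> \<one> \<otimes> u x) \<oplus>\<^bsub>?F\<^esub> u = \<zero>\<^bsub>?F\<^esub>"
        using mem[OF u] by (auto simp: l_minus l_neg)
      ultimately show "\<exists>v\<in>carrier ?F. v \<oplus>\<^bsub>?F\<^esub> u = \<zero>\<^bsub>?F\<^esub>" by blast
    qed (use mem add in \<open>auto simp: a_ac\<close>)
  qed (use mem smult in \<open>auto simp: l_distr r_distr m_assoc\<close>)
qed

lemma (in module) finsupp_module_hom:
  assumes m: "m \<in> S \<rightarrow> carrier M"
  defines "\<phi> \<equiv> \<lambda>u. finsum M (\<lambda>x. u x \<odot>\<^bsub>M\<^esub> m x) {x. u x \<noteq> \<zero>}"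
  shows "\<phi> \<in> module_hom R (finsupp_module R S) M"
proof -
  let ?F = "finsupp_module R S"
  interpret F: module R ?F by (rule finsupp_module)
  have supp: "finite {x. u x \<noteq> \<zero>}" "{x. u x \<noteq> \<zero>} \<subseteq> S" if "u \<in> carrier ?F" for u
    using that by (auto simp: finsupp_module_def)
  have mem: "u x \<in> carrier R" if "u \<in> carrier ?F" for u x
    using that by (cases "x \<in> S") (auto simp: finsupp_module_def)
  have ext: "\<phi> u = finsum M (\<lambda>x. u x \<odot>\<^bsub>M\<^esub> m x) A"
    if u: "u \<in> carrier ?F" and A: "finite A" "{x. u x \<noteq> \<zero>} \<subseteq> A" "A \<subseteq> S" for u A
    unfolding \<phi>_def using A m mem[OF u]
    by (intro M.add.finprod_mono_neutral_cong_left) (auto simp: Pi_iff subset_iff)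
  have closed: "\<phi> u \<in> carrier M" if "u \<in> carrier ?F" for u
    unfolding \<phi>_def using supp[OF that] mem[OF that] m by (intro M.finsum_closed) auto
  have add: "\<phi> (u \<oplus>\<^bsub>?F\<^esub> v) = \<phi> u \<oplus>\<^bsub>M\<^esub> \<phi> v" if u: "u \<in> carrier ?F" and v: "v \<in> carrier ?F" for u v
  proof -
    define A where "A = {x. u x \<noteq> \<zero>} \<union> {x. v x \<noteq> \<zero>}"
    have A: "finite A" "A \<subseteq> S" using supp[OF u] supp[OF v] by (auto simp: A_def)
    have w: "u \<oplus>\<^bsub>?F\<^esub> v \<in> carrier ?F" using u v by simp
    have sum: "(u \<oplus>\<^bsub>?F\<^esub> v) x = u x \<oplus> v x" for x by (simp add: finsupp_module_def)
    have mA: "m \<in> A \<rightarrow> carrier M" using m A by auto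
    have "\<phi> (u \<oplus>\<^bsub>?F\<^esub> v) = finsum M (\<lambda>x. (u \<oplus>\<^bsub>?F\<^esub> v) x \<odot>\<^bsub>M\<^esub> m x) A"
      using A by (intro ext[OF w]) (auto simp: A_def sum)
    also have "\<dots> = finsum M (\<lambda>x. u x \<odot>\<^bsub>M\<^esub> m x \<oplus>\<^bsub>M\<^esub> v x \<odot>\<^bsub>M\<^esub> m x) A"
      using mA mem[OF u] mem[OF v]
      by (intro M.finsum_cong') (auto simp: sum smult_l_distr Pi_iff)
    also have "\<dots> = finsum M (\<lambda>x. u x \<odot>\<^bsub>M\<^esub> m x) A \<oplus>\<^bsub>M\<^esub> finsum M (\<lambda>x. v x \<odot>\<^bsub>M\<^esub> m x) A"
      using mA mem[OF u] mem[OF v] by (intro M.finsum_addf) (auto simp: Pi_iff)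
    also have "\<dots> = \<phi> u \<oplus>\<^bsub>M\<^esub> \<phi> v"
      using ext[OF u, of A] ext[OF v, of A] A by (auto simp: A_def)
    finally show ?thesis .
  qed
  have smult: "\<phi> (c \<odot>\<^bsub>?F\<^esub> u) = c \<odot>\<^bsub>M\<^esub> \<phi> u" if u: "u \<in> carrier ?F" and c: "c \<in> carrier R" for u c
  proof -
    define A where "A = {x. u x \<noteq> \<zero>}"
    have A: "finite A" "A \<subseteq> S" using supp[OF u] by (auto simp: A_def)
    have w: "c \<odot>\<^bsub>?F\<^esub> u \<in> carrier ?F" using u c by simp
    have prod: "(c \<odot>\<^bsub>?F\<^esub> u) x = c \<otimes> u x" for x by (simp add: finsupp_module_def)
    have mA: "m \<in> A \<rightarrow> carrier M" using m A by auto
    have "\<phi> (c \<odot>\<^bsub>?F\<^esub> u) = finsum M (\<lambda>x. (c \<odot>\<^bsub>?F\<^esub> u) x \<odot>\<^bsub>M\<^esub> m x) A"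
      using A c by (intro ext[OF w]) (auto simp: A_def prod)
    also have "\<dots> = finsum M (\<lambda>x. c \<odot>\<^bsub>M\<^esub> (u x \<odot>\<^bsub>M\<^esub> m x)) A"
      using mA mem[OF u] c
      by (intro M.finsum_cong') (auto simp: prod smult_assoc1 Pi_iff)
    also have "\<dots> = c \<odot>\<^bsub>M\<^esub> finsum M (\<lambda>x. u x \<odot>\<^bsub>M\<^esub> m x) A"
      using mA mem[OF u] c A by (intro finsum_smult_ldistr[symmetric]) (auto simp: Pi_iff)
    finally show ?thesis by (simp add: \<phi>_def A_def)
  qed
  show ?thesis using closed add smult by (auto simp: module_hom_def)
qed

lemma module_hom_finsum:
  assumes M: "module R M" and N: "module R N" and g: "g \<in> module_hom R M N"
    and u: "u \<in> A \<rightarrow> carrier R" and m: "m \<in> A \<rightarrow> carrier M" and A: "finite A"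
  shows "g (finsum M (\<lambda>x. u x \<odot>\<^bsub>M\<^esub> m x) A) = finsum N (\<lambda>x. u x \<odot>\<^bsub>N\<^esub> g (m x)) A"
proof -
  interpret mod_hom R M N g
    using M N g by (simp add: mod_hom_def mod_hom_axioms_def)
  show ?thesis using A u m
  proof (induction A rule: finite_induct)
    case empty
    show ?case by simp
  next
    case (insert a A)
    then have "finsum M (\<lambda>x. u x \<odot>\<^bsub>M\<^esub> m x) (insert a A) =
        u a \<odot>\<^bsub>M\<^esub> m a \<oplus>\<^bsub>M\<^esub> finsum M (\<lambda>x. u x \<odot>\<^bsub>M\<^esub> m x) A"
      by (intro M.M.finsum_insert) auto
    moreover have "finsum N (\<lambda>x. u x \<odot>\<^bsub>N\<^esub> g (m x)) (insert a A) =
        u a \<odot>\<^bsub>N\<^esub> g (m a) \<oplus>\<^bsub>N\<^esub> finsum N (\<lambda>x. u x \<odot>\<^bsub>N\<^esub> g (m x)) A"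
      using insert by (intro N.M.finsum_insert) auto
    moreover have "finsum M (\<lambda>x. u x \<odot>\<^bsub>M\<^esub> m x) A \<in> carrier M"
      using insert.prems by (intro M.M.finsum_closed) auto
    ultimately show ?case using insert by auto
  qed
qed

lemma projective_module_lift:
  fixes P :: "('a, 'p, 'k) module_scheme"
    and M :: "('a, 'b, 'k1) module_scheme" and N :: "('a, 'c, 'k2) module_scheme"
  assumes P: "projective_module R P" and M: "module R M" and N: "module R N"
    and g: "g \<in> module_hom R M N" "g ` carrier M = carrier N"
    and f: "f \<in> module_hom R P N"
  shows "\<exists>h \<in> module_hom R P M. \<forall>x \<in> carrier P. g (h x) = f x"
proof -
  interpret P: module R P using P unfolding projective_module_def by (rule conjunct1)
  interpret M: module R M by (rule M)
  let ?S = "carrier P" and ?F = "finsupp_module R (carrier P)"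
  let ?ev = "\<lambda>u. finsum P (\<lambda>x. u x \<odot>\<^bsub>P\<^esub> x) {x. u x \<noteq> \<zero>\<^bsub>R\<^esub>}"
  define P' :: "('a, 'p) module" where
    "P' = \<lparr>carrier = carrier P, monoid.mult = monoid.mult P, one = monoid.one P,
           ring.zero = ring.zero P, add = ring.add P, module.smult = module.smult P\<rparr>"
  have P'_sel: "carrier P' = carrier P" "ring.zero P' = ring.zero P" "ring.add P' = ring.add P"
    "module.smult P' = module.smult P"
    by (simp_all add: P'_def)
  have P': "module R P'"
  proof (rule moduleI)
    show "abelian_group P'"
    proof (rule abelian_groupI, unfold P'_sel)
      fix x assume "x \<in> carrier P"
      then show "\<exists>y\<in>carrier P. y \<oplus>\<^bsub>P\<^esub> x = \<zero>\<^bsub>P\<^esub>"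
        by (intro bexI[of _ "\<ominus>\<^bsub>P\<^esub> x"]) (simp_all add: P.M.l_neg)
    qed (simp_all add: P.M.a_ac)
  qed (auto simp: P'_sel P.R.is_cring P.smult_l_distr P.smult_r_distr P.smult_assoc1)
  have hom_P': "module_hom R A P' = module_hom R A P" "module_hom R P P' = module_hom R P P"
    for A :: "('a, 'p \<Rightarrow> 'a) module"
    by (simp_all add: module_hom_def P'_sel)
  have ev: "?ev \<in> module_hom R ?F P"
    by (rule P.finsupp_module_hom) auto
  have ev_surj: "?ev ` carrier ?F = carrier P"
  proof
    show "?ev ` carrier ?F \<subseteq> carrier P" using ev by (auto simp: module_hom_def)
    show "carrier P \<subseteq> ?ev ` carrier ?F"
    proof
      fix x assume x: "x \<in> carrier P"
      let ?u = "\<lambda>y. if y = x then \<one>\<^bsub>R\<^esub> else \<zero>\<^bsub>R\<^esub>"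
      have u: "?u \<in> carrier ?F"
        using x by (auto simp: finsupp_module_def)
      have "?ev ?u = x"
      proof (cases "\<one>\<^bsub>R\<^esub> = \<zero>\<^bsub>R\<^esub>")
        case True
        then have "{y. ?u y \<noteq> \<zero>\<^bsub>R\<^esub>} = {}" by auto
        moreover have "x = \<zero>\<^bsub>P\<^esub>" using True x using P.smult_l_null[OF x] P.smult_one[OF x] by simp
        ultimately show ?thesis by (simp only: P.M.finsum_empty)
      next
        case False
        then have "{y. ?u y \<noteq> \<zero>\<^bsub>R\<^esub>} = {x}" by auto
        moreover have "finsum P (\<lambda>y. ?u y \<odot>\<^bsub>P\<^esub> y) {x} = x"
          using x by (subst P.M.finsum_insert) auto
        ultimately show ?thesis by (simp only:)
      qed
      with u show "x \<in> ?ev ` carrier ?F" by (intro image_eqI[of _ ?ev ?u]) (simp_all only:)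
    qed
  qed
  have id: "(\<lambda>x. x) \<in> module_hom R P P" by (auto simp: module_hom_def)
  have lift: "\<exists>h \<in> module_hom R P A. \<forall>x \<in> carrier P. q (h x) = p x"
    if "module R A" "module R B" "q \<in> module_hom R A B" "q ` carrier A = carrier B"
      "p \<in> module_hom R P B"
    for A :: "('a, 'p \<Rightarrow> 'a) module" and B :: "('a, 'p) module" and q p
    using P that unfolding projective_module_def by blast
  have "\<exists>s \<in> module_hom R P ?F. \<forall>x \<in> carrier P. ?ev (s x) = x"
    by (rule lift[of ?F P' ?ev "\<lambda>x. x"])
      (use P.R.finsupp_module P' ev ev_surj id in \<open>simp_all add: hom_P' P'_sel\<close>)
  then obtain s where s: "s \<in> module_hom R P ?F" "\<And>x. x \<in> carrier P \<Longrightarrow> ?ev (s x) = x"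
    by auto
  have "\<forall>x \<in> carrier P. \<exists>y \<in> carrier M. g y = f x"
  proof
    fix x assume "x \<in> carrier P"
    then have "f x \<in> g ` carrier M" using f g(2) by (auto simp: module_hom_def)
    then show "\<exists>y \<in> carrier M. g y = f x" by auto
  qed
  then obtain m where m: "\<And>x. x \<in> carrier P \<Longrightarrow> m x \<in> carrier M \<and> g (m x) = f x"
    by metis
  define \<phi> where "\<phi> = (\<lambda>u. finsum M (\<lambda>x. u x \<odot>\<^bsub>M\<^esub> m x) {x. u x \<noteq> \<zero>\<^bsub>R\<^esub>})"
  have \<phi>: "\<phi> \<in> module_hom R ?F M"
    unfolding \<phi>_def using m by (intro M.finsupp_module_hom) auto
  have hom: "(\<lambda>x. \<phi> (s x)) \<in> module_hom R P M"
    using \<phi> s(1) by (auto simp: module_hom_def Pi_iff)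
  have lifts: "g (\<phi> (s x)) = f x" if x: "x \<in> carrier P" for x
  proof -
    let ?A = "{y. s x y \<noteq> \<zero>\<^bsub>R\<^esub>}"
    have sx: "s x \<in> carrier ?F" using s(1) x by (auto simp: module_hom_def)
    have A: "finite ?A" "?A \<subseteq> carrier P" "s x \<in> ?A \<rightarrow> carrier R"
      using sx by (auto simp: finsupp_module_def)
    have mA: "m \<in> ?A \<rightarrow> carrier M" "(\<lambda>y. y) \<in> ?A \<rightarrow> carrier P"
      using A(2) m by auto
    interpret N: module R N by (rule N)
    have fA: "s x y \<odot>\<^bsub>N\<^esub> f y \<in> carrier N" if "y \<in> ?A" for y
    proof -
      have "y \<in> carrier P" "s x y \<in> carrier R" using that A by auto
      then show ?thesis using f by (auto simp: module_hom_def)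
    qed
    have "g (\<phi> (s x)) = finsum N (\<lambda>y. s x y \<odot>\<^bsub>N\<^esub> g (m y)) ?A"
      unfolding \<phi>_def by (rule module_hom_finsum[OF M N g(1) A(3) mA(1) A(1)])
    also have "\<dots> = finsum N (\<lambda>y. s x y \<odot>\<^bsub>N\<^esub> f y) ?A"
    proof (rule N.M.finsum_cong')
      show "(\<lambda>y. s x y \<odot>\<^bsub>N\<^esub> f y) \<in> ?A \<rightarrow> carrier N" using fA by (rule Pi_I)
      fix y assume "y \<in> ?A"
      then show "s x y \<odot>\<^bsub>N\<^esub> g (m y) = s x y \<odot>\<^bsub>N\<^esub> f y" using A(2) m by (metis subsetD)
    qed (rule refl)
    also have "\<dots> = f (?ev (s x))"
      by (rule module_hom_finsum[OF P.module_axioms N f A(3) mA(2) A(1), symmetric])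
    finally show ?thesis by (simp only: s(2)[OF x])
  qed
  show ?thesis by (intro bexI[OF _ hom] ballI lifts)
qed

end

theory Submission
  imports Defs
begin

text \<open>
  Let \<open>\<O> = \<int>[\<surd>d]\<close> with \<open>d \<in> {-3, -7}\<close>, let \<open>\<O>\<^sub>K\<close> be the maximal order, which is Euclidean, and let
  \<open>\<m> = 2 \<O>\<^sub>K\<close> be the maximal ideal of index 2 in \<open>\<O>\<close>. An ideal \<open>I\<close> of \<open>\<O>\<close> that is not contained in \<open>\<m>\<close> is
  principal: \<open>I \<inter> \<m>\<close> is a principal ideal of \<open>\<O>\<^sub>K\<close>, and units of \<open>\<O>\<^sub>K\<close> move the elements of odd norm
  into \<open>\<O>\<close>. If \<open>P\<close> is a nonzero finitely generated projective module, some coordinate form \<open>f\<close> of a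
  dual basis takes values outside \<open>\<m>\<close>, since otherwise \<open>P = \<m> P\<close>. Then \<open>f(P) = c \<O>\<close>, so that \<open>P\<close> is the
  direct sum of a free module of rank one and the kernel of \<open>f\<close>, on which fewer coordinate forms
  are nonzero.
\<close>

section \<open>Splitting off free summands\<close>

text \<open>The elements of \<open>Q k\<close> play the role of the \<open>k\<close>-th power of the ideal \<open>Q 1\<close>.\<close>

locale principal_filtration = domain R for R (structure) +
  fixes Q :: "nat \<Rightarrow> 'a set"
  assumes Q_ideal: "ideal (Q k) R"
    and Q_0: "Q 0 = carrier R"
    and Q_mult: "a \<in> Q k \<Longrightarrow> b \<in> Q 1 \<Longrightarrow> a \<otimes> b \<in> Q (Suc k)"
    and Q_separated: "(\<Inter>k. Q k) = {\<zero>}"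
    and principal: "ideal I R \<Longrightarrow> \<not> I \<subseteq> Q 1 \<Longrightarrow> \<exists>c\<in>I. I = PIdl c"

context module
begin

definition linear_forms :: "('c \<Rightarrow> 'a) set" where
  "linear_forms = {f. f \<in> carrier M \<rightarrow> carrier R \<and>
     (\<forall>x\<in>carrier M. \<forall>y\<in>carrier M. f (x \<oplus>\<^bsub>M\<^esub> y) = f x \<oplus> f y) \<and>
     (\<forall>c\<in>carrier R. \<forall>x\<in>carrier M. f (c \<odot>\<^bsub>M\<^esub> x) = c \<otimes> f x)}"

lemma linear_formsD:
  assumes "f \<in> linear_forms"
  shows linear_form_closed: "x \<in> carrier M \<Longrightarrow> f x \<in> carrier R"
    and linear_form_add: "x \<in> carrier M \<Longrightarrow> y \<in> carrier M \<Longrightarrow> f (x \<oplus>\<^bsub>M\<^esub> y) = f x \<oplus> f y"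
    and linear_form_smult: "c \<in> carrier R \<Longrightarrow> x \<in> carrier M \<Longrightarrow> f (c \<odot>\<^bsub>M\<^esub> x) = c \<otimes> f x"
  using assms by (auto simp: linear_forms_def)

lemma linear_form_zero: "f \<in> linear_forms \<Longrightarrow> f \<zero>\<^bsub>M\<^esub> = \<zero>"
  using linear_form_smult[of f \<zero> "\<zero>\<^bsub>M\<^esub>"] linear_form_closed[of f "\<zero>\<^bsub>M\<^esub>"] by simp

lemma linear_form_minus:
  assumes "f \<in> linear_forms" "x \<in> carrier M" "y \<in> carrier M"
  shows "f (x \<ominus>\<^bsub>M\<^esub> y) = f x \<ominus> f y"
proof -
  have "f (x \<ominus>\<^bsub>M\<^esub> y) = f x \<oplus> f ((\<ominus> \<one>) \<odot>\<^bsub>M\<^esub> y)"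
    using assms linear_form_add[OF assms(1)] by (simp add: M.minus_eq smult_l_minus)
  also have "\<dots> = f x \<ominus> f y"
    using assms linear_form_closed[OF assms(1)]
    by (simp add: linear_form_smult[OF assms(1)] R.minus_eq R.l_minus)
  finally show ?thesis .
qed

lemma linear_form_finsum:
  assumes f: "f \<in> linear_forms" and A: "finite A"
    and "a \<in> A \<rightarrow> carrier R" "g \<in> A \<rightarrow> carrier M"
  shows "f (\<Oplus>\<^bsub>M\<^esub>x\<in>A. a x \<odot>\<^bsub>M\<^esub> g x) = (\<Oplus>x\<in>A. a x \<otimes> f (g x))"
  using A assms(3-)
proof (induction A rule: finite_induct)
  case empty
  show ?case by (simp add: linear_form_zero[OF f])
next
  case (insert z A)
  have "(\<Oplus>\<^bsub>M\<^esub>x\<in>A. a x \<odot>\<^bsub>M\<^esub> g x) \<in> carrier M"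
    using insert.prems by (intro M.finsum_closed) auto
  moreover have "(\<Oplus>\<^bsub>M\<^esub>x\<in>insert z A. a x \<odot>\<^bsub>M\<^esub> g x)
      = a z \<odot>\<^bsub>M\<^esub> g z \<oplus>\<^bsub>M\<^esub> (\<Oplus>\<^bsub>M\<^esub>x\<in>A. a x \<odot>\<^bsub>M\<^esub> g x)"
    using insert by (intro M.finsum_insert) auto
  moreover have "(\<Oplus>x\<in>insert z A. a x \<otimes> f (g x)) = a z \<otimes> f (g z) \<oplus> (\<Oplus>x\<in>A. a x \<otimes> f (g x))"
    using insert by (intro R.finsum_insert) (auto simp: linear_form_closed[OF f] Pi_iff)
  ultimately show ?case
    using insert by (auto simp: linear_form_add[OF f] linear_form_smult[OF f])
qed

lemma linear_form_image_ideal: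
  assumes f: "f \<in> linear_forms" and N: "submodule R N M"
  shows "ideal (f ` N) R"
proof (rule idealI)
  interpret N: submodule R N M by (rule N)
  note closed = linear_form_closed[OF f subsetD[OF N.subset]]
  have neg: "\<ominus> f x \<in> f ` N" if "x \<in> N" for x
  proof
    show "\<ominus> \<one> \<odot>\<^bsub>M\<^esub> x \<in> N" using that by simp
    show "\<ominus> f x = f (\<ominus> \<one> \<odot>\<^bsub>M\<^esub> x)"
      using that N.subset closed by (subst linear_form_smult[OF f]) (auto simp: R.l_minus)
  qed
  show "subgroup (f ` N) (add_monoid R)"
  proof (rule R.add.subgroupI)
    show "f ` N \<noteq> {}" using N.zero_closed by blast
    show "\<ominus> a \<in> f ` N" if "a \<in> f ` N" for a using neg that by auto
    show "a \<oplus> b \<in> f ` N" if ab: "a \<in> f ` N" "b \<in> f ` N" for a b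
    proof -
      obtain x y where "x \<in> N" "y \<in> N" "a = f x" "b = f y" using ab by auto
      moreover from this have "f (x \<oplus>\<^bsub>M\<^esub> y) = f x \<oplus> f y"
        using N.subset by (intro linear_form_add f) blast+
      ultimately show ?thesis using N.m_closed by (metis image_eqI)
    qed
  qed (use closed in auto)
  fix a c assume "a \<in> f ` N" and c: "c \<in> carrier R"
  then obtain x where x: "x \<in> N" "a = f x" by auto
  then have "c \<otimes> a = f (c \<odot>\<^bsub>M\<^esub> x)" using c N.subset linear_form_smult[OF f, of c x] by auto
  then show "c \<otimes> a \<in> f ` N" using x c by auto
  then show "a \<otimes> c \<in> f ` N" using closed[OF x(1)] x c by (simp add: R.m_comm)
qed (rule R.ring_axioms)

text \<open>The coordinate forms are defined on all of \<open>M\<close>, so that they can be kept when \<open>N\<close> is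
  replaced by a direct summand.\<close>

definition dual_basis :: "'i set \<Rightarrow> ('i \<Rightarrow> 'c \<Rightarrow> 'a) \<Rightarrow> ('i \<Rightarrow> 'c) \<Rightarrow> 'c set \<Rightarrow> bool" where
  "dual_basis S F e N \<longleftrightarrow> finite S \<and> F \<in> S \<rightarrow> linear_forms \<and> e \<in> S \<rightarrow> N \<and>
     (\<forall>x\<in>N. x = (\<Oplus>\<^bsub>M\<^esub>z\<in>S. F z x \<odot>\<^bsub>M\<^esub> e z))"

lemma dual_basis_zero:
  assumes "dual_basis S F e N" "submodule R N M" "\<And>z x. z \<in> S \<Longrightarrow> x \<in> N \<Longrightarrow> F z x = \<zero>"
  shows "N = {\<zero>\<^bsub>M\<^esub>}"
proof
  interpret N: submodule R N M by fact
  show "N \<subseteq> {\<zero>\<^bsub>M\<^esub>}"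
  proof
    fix x assume x: "x \<in> N"
    have "x = (\<Oplus>\<^bsub>M\<^esub>z\<in>S. F z x \<odot>\<^bsub>M\<^esub> e z)" using assms(1) x unfolding dual_basis_def by blast
    also have "\<dots> = (\<Oplus>\<^bsub>M\<^esub>z\<in>S. \<zero>\<^bsub>M\<^esub>)"
      using assms x N.subset by (intro M.finsum_cong') (auto simp: dual_basis_def Pi_iff subset_iff)
    finally show "x \<in> {\<zero>\<^bsub>M\<^esub>}" by simp
  qed
  show "{\<zero>\<^bsub>M\<^esub>} \<subseteq> N" by simp
qed

text \<open>Plays the role of Nakayama's lemma: the matrix of coordinates of the dual basis is idempotent,
  so if its entries lie in \<open>Q 1\<close> they lie in every \<open>Q k\<close>.\<close>

lemma dual_basis_filtration_zero:
  assumes "principal_filtration R Q" and dual: "dual_basis S F e N" and N: "submodule R N M"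
    and sub: "\<And>z. z \<in> S \<Longrightarrow> F z ` N \<subseteq> Q 1"
  shows "N = {\<zero>\<^bsub>M\<^esub>}"
proof (rule dual_basis_zero[OF dual N])
  interpret principal_filtration R Q by fact
  interpret N: submodule R N M by (rule N)
  have S: "finite S" and F: "\<And>z. z \<in> S \<Longrightarrow> F z \<in> linear_forms" and e: "e \<in> S \<rightarrow> N"
    and expand: "\<And>x. x \<in> N \<Longrightarrow> x = (\<Oplus>\<^bsub>M\<^esub>z\<in>S. F z x \<odot>\<^bsub>M\<^esub> e z)"
    using dual unfolding dual_basis_def by auto
  have eM: "e \<in> S \<rightarrow> carrier M" using e N.subset by auto
  have "F z x \<in> Q k" if "z \<in> S" "x \<in> N" for z x k
    using that
  proof (induction k arbitrary: z x)
    case 0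
    then show ?case using F N.subset by (auto simp: Q_0 intro: linear_form_closed)
  next
    case (Suc k)
    interpret Q: ideal "Q (Suc k)" R by (rule Q_ideal)
    have "F z x = F z (\<Oplus>\<^bsub>M\<^esub>v\<in>S. F v x \<odot>\<^bsub>M\<^esub> e v)" using expand[OF Suc.prems(2)] by simp
    also have "\<dots> = (\<Oplus>v\<in>S. F v x \<otimes> F z (e v))"
      using Suc.prems N.subset F eM
      by (intro linear_form_finsum F S) (auto intro: linear_form_closed)
    also have "\<dots> \<in> Q (Suc k)"
    proof -
      have "F v x \<otimes> F z (e v) \<in> Q (Suc k)" if "v \<in> S" for v
      proof (rule Q_mult)
        show "F v x \<in> Q k" using that Suc by simp
        show "F z (e v) \<in> Q 1" using that e sub[OF Suc.prems(1)] by (auto simp: Pi_iff)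
      qed
      then have *: "(\<lambda>v. F v x \<otimes> F z (e v)) \<in> S \<rightarrow> Q (Suc k)" by simp
      show ?thesis using S *
      proof (induction S rule: finite_induct)
        case (insert v A)
        have "(\<lambda>v. F v x \<otimes> F z (e v)) \<in> A \<rightarrow> carrier R" "F v x \<otimes> F z (e v) \<in> carrier R"
          using insert.prems Q.Icarr by (simp_all add: Pi_iff)
        then have "(\<Oplus>v\<in>insert v A. F v x \<otimes> F z (e v))
            = F v x \<otimes> F z (e v) \<oplus> (\<Oplus>v\<in>A. F v x \<otimes> F z (e v))"
          using insert.hyps by (intro R.finsum_insert)
        then show ?case using insert by auto
      qed simp
    qed
    finally show ?case .
  qed
  then show "F z x = \<zero>" if "z \<in> S" "x \<in> N" for z x using Q_separated that by blast
qed

lemma dual_basis_split: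
  assumes "domain R" and dual: "dual_basis S F e N" and N: "submodule R N M" and y: "y \<in> S"
    and x: "x \<in> N" "F y x \<noteq> \<zero>" and image: "F y ` N = PIdl (F y x)"
  defines "N' \<equiv> {v \<in> N. F y v = \<zero>}"
  shows "submodule R N' M" "\<exists>e'. dual_basis S F e' N'"
    "\<And>v. v \<in> N \<Longrightarrow> \<exists>r\<in>carrier R. v \<ominus>\<^bsub>M\<^esub> r \<odot>\<^bsub>M\<^esub> x \<in> N'"
proof -
  interpret domain R by fact
  interpret N: submodule R N M by (rule N)
  have S: "finite S" and F: "\<And>z. z \<in> S \<Longrightarrow> F z \<in> linear_forms" and e: "e \<in> S \<rightarrow> N"
    and expand: "\<And>x. x \<in> N \<Longrightarrow> x = (\<Oplus>\<^bsub>M\<^esub>z\<in>S. F z x \<odot>\<^bsub>M\<^esub> e z)"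
    using dual unfolding dual_basis_def by auto
  note Fy = linear_formsD[OF F[OF y]]
  have inM: "v \<in> carrier M" if "v \<in> N" for v using that N.subset by auto
  have eM: "e z \<in> carrier M" if "z \<in> S" for z using that e inM by auto
  have FR: "F z v \<in> carrier R" if "z \<in> S" "v \<in> N" for z v
    using that by (intro linear_form_closed F inM)
  show N': "submodule R N' M"
  proof (rule submodule.intro)
    show "module R M" by (rule module_axioms)
    show "N' \<subseteq> carrier M" using inM by (auto simp: N'_def)
    show "v \<oplus>\<^bsub>M\<^esub> w \<in> N'" if "v \<in> N'" "w \<in> N'" for v w
      using that by (auto simp: N'_def Fy inM)
    show "\<zero>\<^bsub>M\<^esub> \<in> N'" by (simp add: N'_def linear_form_zero F y)
    show "c \<odot>\<^bsub>M\<^esub> v \<in> N'" if "c \<in> carrier R" "v \<in> N'" for c v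
      using that by (auto simp: N'_def Fy inM)
  qed
  have minus: "v \<ominus>\<^bsub>M\<^esub> w \<in> N" if "v \<in> N" "w \<in> N" for v w
  proof -
    have "v \<ominus>\<^bsub>M\<^esub> w = v \<oplus>\<^bsub>M\<^esub> (\<ominus> \<one>) \<odot>\<^bsub>M\<^esub> w" using that inM by (simp add: M.minus_eq smult_l_minus)
    then show ?thesis using that by simp
  qed
  have proj: "\<exists>r\<in>carrier R. F y v = r \<otimes> F y x \<and> v \<ominus>\<^bsub>M\<^esub> r \<odot>\<^bsub>M\<^esub> x \<in> N'" if v: "v \<in> N" for v
  proof -
    have "F y v \<in> PIdl (F y x)" using v image by auto
    then obtain r where r: "r \<in> carrier R" "F y v = r \<otimes> F y x"
      unfolding cgenideal_def by auto
    have "F y (v \<ominus>\<^bsub>M\<^esub> r \<odot>\<^bsub>M\<^esub> x) = r \<otimes> F y x \<ominus> r \<otimes> F y x"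
      using r v x inM by (simp add: linear_form_minus F y Fy)
    then have "v \<ominus>\<^bsub>M\<^esub> r \<odot>\<^bsub>M\<^esub> x \<in> N'"
      using r v x minus FR y by (simp add: N'_def R.minus_eq R.r_neg)
    then show ?thesis using r by blast
  qed
  then show "\<And>v. v \<in> N \<Longrightarrow> \<exists>r\<in>carrier R. v \<ominus>\<^bsub>M\<^esub> r \<odot>\<^bsub>M\<^esub> x \<in> N'" by blast
  have "\<forall>z\<in>S. \<exists>r. r \<in> carrier R \<and> F y (e z) = r \<otimes> F y x \<and> e z \<ominus>\<^bsub>M\<^esub> r \<odot>\<^bsub>M\<^esub> x \<in> N'"
    using proj e by blast
  then obtain r where r: "\<forall>z\<in>S. r z \<in> carrier R \<and> F y (e z) = r z \<otimes> F y x \<and> e z \<ominus>\<^bsub>M\<^esub> r z \<odot>\<^bsub>M\<^esub> x \<in> N'"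
    unfolding bchoice_iff by blast
  define e' where "e' = (\<lambda>z. e z \<ominus>\<^bsub>M\<^esub> r z \<odot>\<^bsub>M\<^esub> x)"
  have "v = (\<Oplus>\<^bsub>M\<^esub>z\<in>S. F z v \<odot>\<^bsub>M\<^esub> e' z)" if v: "v \<in> N'" for v
  proof -
    have vN: "v \<in> N" and vy: "F y v = \<zero>" using v by (auto simp: N'_def)
    define t where "t = (\<Oplus>z\<in>S. F z v \<otimes> r z)"
    have t: "t \<in> carrier R" unfolding t_def using r FR vN by (intro R.finsum_closed) auto
    have "\<zero> = F y (\<Oplus>\<^bsub>M\<^esub>z\<in>S. F z v \<odot>\<^bsub>M\<^esub> e z)" using vy expand[OF vN] by simp
    also have "\<dots> = (\<Oplus>z\<in>S. F z v \<otimes> F y (e z))"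
      using FR vN eM by (intro linear_form_finsum F y S) auto
    also have "\<dots> = (\<Oplus>z\<in>S. F z v \<otimes> r z \<otimes> F y x)"
      using r FR vN x y by (intro R.finsum_cong') (auto simp: R.m_assoc)
    also have "\<dots> = t \<otimes> F y x"
      unfolding t_def using r FR vN x y S by (intro R.finsum_ldistr[symmetric]) auto
    finally have "t = \<zero>" using t x FR y integral by metis
    have "(\<Oplus>\<^bsub>M\<^esub>z\<in>S. F z v \<odot>\<^bsub>M\<^esub> e z)
        = (\<Oplus>\<^bsub>M\<^esub>z\<in>S. F z v \<odot>\<^bsub>M\<^esub> e' z \<oplus>\<^bsub>M\<^esub> (F z v \<otimes> r z) \<odot>\<^bsub>M\<^esub> x)"
    proof (rule M.finsum_cong')
      fix z assume z: "z \<in> S"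
      have "e z = e' z \<oplus>\<^bsub>M\<^esub> r z \<odot>\<^bsub>M\<^esub> x"
        using z r eM x inM by (simp add: e'_def M.minus_eq M.a_assoc M.l_neg)
      moreover have "e' z \<in> carrier M" using z r eM x inM by (simp add: e'_def)
      ultimately show "F z v \<odot>\<^bsub>M\<^esub> e z = F z v \<odot>\<^bsub>M\<^esub> e' z \<oplus>\<^bsub>M\<^esub> (F z v \<otimes> r z) \<odot>\<^bsub>M\<^esub> x"
        using z r x inM FR vN by (simp add: smult_r_distr smult_assoc1)
    qed (use r eM x inM FR vN in \<open>auto simp: e'_def\<close>)
    also have "\<dots> = (\<Oplus>\<^bsub>M\<^esub>z\<in>S. F z v \<odot>\<^bsub>M\<^esub> e' z) \<oplus>\<^bsub>M\<^esub> (\<Oplus>\<^bsub>M\<^esub>z\<in>S. (F z v \<otimes> r z) \<odot>\<^bsub>M\<^esub> x)"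
      using r eM x inM FR vN by (intro M.finsum_addf) (auto simp: e'_def)
    also have "(\<Oplus>\<^bsub>M\<^esub>z\<in>S. (F z v \<otimes> r z) \<odot>\<^bsub>M\<^esub> x) = t \<odot>\<^bsub>M\<^esub> x"
      unfolding t_def using r FR vN x inM by (intro finsum_smult_r[symmetric]) auto
    also have "\<dots> = \<zero>\<^bsub>M\<^esub>" using \<open>t = \<zero>\<close> x inM by simp
    finally have "(\<Oplus>\<^bsub>M\<^esub>z\<in>S. F z v \<odot>\<^bsub>M\<^esub> e z) = (\<Oplus>\<^bsub>M\<^esub>z\<in>S. F z v \<odot>\<^bsub>M\<^esub> e' z)"
      using r eM x inM FR vN by (subst (asm) M.r_zero) (auto simp: e'_def intro!: M.finsum_closed)
    then show ?thesis using expand[OF vN] by simp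
  qed
  moreover have "e' \<in> S \<rightarrow> N'" using r by (simp add: e'_def)
  ultimately show "\<exists>e'. dual_basis S F e' N'" using S F by (auto simp: dual_basis_def)
qed

lemma lin_indpt_insert:
  assumes "domain R" and f: "f \<in> linear_forms" and x: "x \<in> carrier M" "f x \<noteq> \<zero>"
    and B: "finite B" "B \<subseteq> carrier M" "lin_indpt B" "\<And>b. b \<in> B \<Longrightarrow> f b = \<zero>"
  shows "lin_indpt (insert x B)"
proof (rule finite_lin_indpt2)
  interpret domain R by fact
  have xB: "x \<notin> B" using B x by auto
  fix a assume a: "a \<in> insert x B \<rightarrow> carrier R" and "lincomb a (insert x B) = \<zero>\<^bsub>M\<^esub>"
  then have zero: "a x \<odot>\<^bsub>M\<^esub> x \<oplus>\<^bsub>M\<^esub> lincomb a B = \<zero>\<^bsub>M\<^esub>"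
    using lincomb_insert[of B a x] B x xB by auto
  have lB: "lincomb a B \<in> carrier M" using B a by auto
  have "f (lincomb a B) = (\<Oplus>z\<in>B. a z \<otimes> f z)"
    unfolding lincomb_def using B a by (intro linear_form_finsum f) auto
  also have "\<dots> = (\<Oplus>z\<in>B. \<zero>)" using B a by (intro R.finsum_cong') (auto simp: Pi_iff)
  finally have fB: "f (lincomb a B) = \<zero>" by simp
  have "f (a x \<odot>\<^bsub>M\<^esub> x \<oplus>\<^bsub>M\<^esub> lincomb a B) = a x \<otimes> f x"
    using a x lB fB by (simp add: linear_formsD[OF f] Pi_iff)
  then have "a x \<otimes> f x = \<zero>" using zero linear_form_zero[OF f] by simp
  then have ax: "a x = \<zero>" using a x linear_form_closed[OF f x(1)] integral[of "a x" "f x"] by auto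
  then have "lincomb a B = \<zero>\<^bsub>M\<^esub>" using zero lB x by simp
  then have "a v = \<zero>" if "v \<in> B" for v
    using that a B by (auto simp: lin_dep_def)
  then show "\<forall>v\<in>insert x B. a v = \<zero>" using ax by simp
qed (use B x in auto)

lemma dual_basis_imp_basis:
  assumes "principal_filtration R Q" "dual_basis S F e N" "submodule R N M"
  shows "\<exists>B. finite B \<and> B \<subseteq> N \<and> lin_indpt B \<and> N \<subseteq> span B"
  using assms(2,3)
proof (induction "card {z \<in> S. \<exists>v\<in>N. F z v \<noteq> \<zero>}" arbitrary: N e rule: less_induct)
  case less
  interpret principal_filtration R Q by fact
  interpret N: submodule R N M by (rule less.prems)
  have F: "\<And>z. z \<in> S \<Longrightarrow> F z \<in> linear_forms" and S: "finite S"
    using less.prems by (auto simp: dual_basis_def)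
  show ?case
  proof (cases "N = {\<zero>\<^bsub>M\<^esub>}")
    case True
    have "lin_indpt {}" by (auto simp: lin_dep_def)
    moreover have "\<zero>\<^bsub>M\<^esub> \<in> span {}" unfolding span_def lincomb_def by auto
    ultimately show ?thesis using True by (intro exI[of _ "{}"]) auto
  next
    case False
    then obtain y where y: "y \<in> S" "\<not> F y ` N \<subseteq> Q 1"
      using dual_basis_filtration_zero[OF assms(1) less.prems] by blast
    obtain c where c: "c \<in> F y ` N" "F y ` N = PIdl c"
      using principal[OF linear_form_image_ideal[OF F less.prems(2)]] y by blast
    then obtain x where x: "x \<in> N" "c = F y x" by auto
    have xM: "x \<in> carrier M" using x N.subset by auto
    have "PIdl \<zero> = {\<zero>}" by (auto simp: cgenideal_def intro!: exI[of _ \<zero>])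
    moreover have "\<zero> \<in> Q 1" using Q_ideal additive_subgroup.zero_closed ideal.axioms(1) by blast
    ultimately have "F y x \<noteq> \<zero>" using c x y by auto
    define N' where "N' = {v \<in> N. F y v = \<zero>}"
    note split = dual_basis_split[OF domain_axioms less.prems y(1) x(1) \<open>F y x \<noteq> \<zero>\<close>
        c(2)[unfolded x(2)], folded N'_def]
    obtain e' where e': "dual_basis S F e' N'" using split(2) by blast
    have "card {z \<in> S. \<exists>v\<in>N'. F z v \<noteq> \<zero>} < card {z \<in> S. \<exists>v\<in>N. F z v \<noteq> \<zero>}"
    proof (rule psubset_card_mono)
      have "y \<in> {z \<in> S. \<exists>v\<in>N. F z v \<noteq> \<zero>}" "y \<notin> {z \<in> S. \<exists>v\<in>N'. F z v \<noteq> \<zero>}"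
        using y x \<open>F y x \<noteq> \<zero>\<close> by (auto simp: N'_def)
      then show "{z \<in> S. \<exists>v\<in>N'. F z v \<noteq> \<zero>} \<subset> {z \<in> S. \<exists>v\<in>N. F z v \<noteq> \<zero>}"
        by (auto simp: N'_def)
    qed (use S in auto)
    from less.hyps[OF this e' split(1)] obtain B
      where B: "finite B" "B \<subseteq> N'" "lin_indpt B" "N' \<subseteq> span B" by blast
    have B_sub: "B \<subseteq> N" "B \<subseteq> carrier M" using B N.subset by (auto simp: N'_def)
    have "lin_indpt (insert x B)"
      using B B_sub y xM \<open>F y x \<noteq> \<zero>\<close>
      by (intro lin_indpt_insert[OF domain_axioms F]) (auto simp: N'_def)
    moreover have "N \<subseteq> span (insert x B)"
    proof
      fix v assume v: "v \<in> N"
      then obtain r where r: "r \<in> carrier R" "v \<ominus>\<^bsub>M\<^esub> r \<odot>\<^bsub>M\<^esub> x \<in> N'" using split(3) by blast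
      interpret span: submodule R "span (insert x B)" M
        using B_sub xM by (intro span_is_submodule) auto
      have "x \<in> span (insert x B)" using in_own_span[of "insert x B"] B_sub xM by auto
      moreover have "v \<ominus>\<^bsub>M\<^esub> r \<odot>\<^bsub>M\<^esub> x \<in> span (insert x B)"
        using r B span_is_monotone[of B "insert x B"] by blast
      ultimately have "(v \<ominus>\<^bsub>M\<^esub> r \<odot>\<^bsub>M\<^esub> x) \<oplus>\<^bsub>M\<^esub> r \<odot>\<^bsub>M\<^esub> x \<in> span (insert x B)"
        using r by simp
      moreover have "v \<in> carrier M" using v N.subset by auto
      ultimately show "v \<in> span (insert x B)"
        using r xM by (simp add: M.minus_eq M.a_assoc M.l_neg)
    qed
    ultimately show ?thesis using B B_sub x by (intro exI[of _ "insert x B"]) auto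
  qed
qed

lemma projective_imp_dual_basis:
  assumes P: "projective_module R M" and S: "finite S" "S \<subseteq> carrier M" "gen_set S"
  shows "\<exists>F. dual_basis S F (\<lambda>z. z) (carrier M)"
proof -
  let ?L = "finsupp_module R S"
  let ?ev = "\<lambda>u. finsum M (\<lambda>x. u x \<odot>\<^bsub>M\<^esub> x) {x. u x \<noteq> \<zero>}"
  have ev: "?ev \<in> module_hom R ?L M" using S by (intro finsupp_module_hom) auto
  have ext: "?ev u = finsum M (\<lambda>x. u x \<odot>\<^bsub>M\<^esub> x) S" if u: "u \<in> carrier ?L" for u
  proof (rule M.add.finprod_mono_neutral_cong_left)
    show "{x. u x \<noteq> \<zero>} \<subseteq> S" using u by (auto simp: finsupp_module_def)
    show "(\<lambda>x. u x \<odot>\<^bsub>M\<^esub> x) \<in> S \<rightarrow> carrier M" using u S by (auto simp: finsupp_module_def)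
  qed (use S in auto)
  have "carrier M \<subseteq> ?ev ` carrier ?L"
  proof
    fix x assume "x \<in> carrier M"
    then obtain a where a: "a \<in> S \<rightarrow> carrier R" "lincomb a S = x"
      using finite_in_span[of S x] S by auto
    define u where "u = (\<lambda>z. if z \<in> S then a z else \<zero>)"
    have u: "u \<in> carrier ?L"
      using a S by (auto simp: u_def finsupp_module_def intro: finite_subset[of _ S])
    have "?ev u = x"
      unfolding ext[OF u] a(2)[symmetric] lincomb_def
      using a S by (intro M.finsum_cong') (auto simp: u_def)
    then show "x \<in> ?ev ` carrier ?L" using u by blast
  qed
  then have surj: "?ev ` carrier ?L = carrier M" using ev by (auto simp: module_hom_def)
  have "(\<lambda>x. x) \<in> module_hom R M M" by (auto simp: module_hom_def)
  from projective_module_lift[OF P finsupp_module module_axioms ev surj this]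
  obtain s where s: "s \<in> module_hom R M ?L" "\<forall>x\<in>carrier M. ?ev (s x) = x" by blast
  have "(\<lambda>x. s x z) \<in> linear_forms" if "z \<in> S" for z
    using s(1) that by (auto simp: linear_forms_def module_hom_def finsupp_module_def Pi_iff)
  moreover have "x = (\<Oplus>\<^bsub>M\<^esub>z\<in>S. s x z \<odot>\<^bsub>M\<^esub> z)" if "x \<in> carrier M" for x
    using s that ext[of "s x"] by (auto simp: module_hom_def Pi_iff)
  ultimately have "dual_basis S (\<lambda>z x. s x z) (\<lambda>z. z) (carrier M)"
    using S by (auto simp: dual_basis_def)
  then show ?thesis by blast
qed

end

theorem (in principal_filtration) projective_free: "projective_free TYPE('m) R"
  unfolding projective_free_def
proof (intro conjI allI impI)
  show "domain R" by (rule domain_axioms)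
  fix M :: "('a, 'm) module"
  assume M: "fin_gen_module R M \<and> projective_module R M"
  then interpret M: module R M by (simp add: fin_gen_module_def)
  obtain S where S: "finite S" "S \<subseteq> carrier M" "M.gen_set S"
    using M by (auto simp: fin_gen_module_def)
  obtain F where F: "M.dual_basis S F (\<lambda>z. z) (carrier M)"
    using M.projective_imp_dual_basis[OF _ S] M by blast
  have "submodule R (carrier M) M" by (simp add: submodule_def M.module_axioms)
  from M.dual_basis_imp_basis[OF principal_filtration_axioms F this]
  obtain B where B: "B \<subseteq> carrier M" "M.lin_indpt B" "carrier M \<subseteq> M.span B" by blast
  then show "free_module R M"
    using M.span_is_subset2[of B] M.module_axioms unfolding free_module_def by blast
qed

section \<open>Imaginary quadratic orders of index two\<close>

lemma csqrt_of_int_neg: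
  assumes "d < 0"
  shows "csqrt (of_int d) = \<i> * of_real (sqrt (of_int (- d)))"
  using csqrt_of_real_nonpos[of "of_int d"] assms by simp

locale imaginary_order =
  fixes d :: int
  assumes d_neg: "d < 0" and d_bound: "- 12 < d" and d_mod_4: "4 dvd d - 1"
begin

definition \<omega> :: complex where "\<omega> = csqrt (of_int d)"

definition \<O> :: "complex set" where
  "\<O> = {of_int a + of_int b * \<omega> | a b. True}"

definition \<m> :: "complex set" where
  "\<m> = {of_int a + of_int b * \<omega> | a b. even (a + b)}"

text \<open>\<open>\<m>\<close> is the conductor of \<open>\<O>\<close> in the maximal order \<open>\<O>\<^sub>K\<close>, whence this description of \<open>\<O>\<^sub>K\<close>.\<close>

definition \<O>\<^sub>K :: "complex set" where
  "\<O>\<^sub>K = {z. 2 * z \<in> \<m>}"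

lemma omega_square: "\<omega> * \<omega> = of_int d"
  unfolding \<omega>_def by (metis power2_csqrt power2_eq_square)

lemma omega_eq: "\<omega> = \<i> * of_real (sqrt (of_int (- d)))"
  unfolding \<omega>_def by (rule csqrt_of_int_neg[OF d_neg])

lemma cnj_omega: "cnj \<omega> = - \<omega>"
  by (simp add: omega_eq)

lemma real_plus_real_omega_eq_iff:
  "of_real x + of_real y * \<omega> = of_real x' + of_real y' * \<omega> \<longleftrightarrow> x = x' \<and> y = y'"
  using d_neg by (auto simp: omega_eq complex_eq_iff)

lemma int_plus_int_omega_eq_iff:
  "of_int a + of_int b * \<omega> = of_int a' + of_int b' * \<omega> \<longleftrightarrow> a = a' \<and> b = b'"
  using real_plus_real_omega_eq_iff[of "of_int a" "of_int b" "of_int a'" "of_int b'"] by simp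

lemma cmod_omega_square: "(cmod (of_real x + of_real y * \<omega>))\<^sup>2 = x\<^sup>2 - of_int d * y\<^sup>2"
  using d_neg by (simp add: omega_eq cmod_power2 power_mult_distrib)

lemma mult_expand:
  "(of_int a + of_int b * \<omega>) * (of_int a' + of_int b' * \<omega>)
    = of_int (a * a' + d * (b * b')) + of_int (a * b' + b * a') * \<omega>"
proof -
  have "(of_int a + of_int b * \<omega>) * (of_int a' + of_int b' * \<omega>)
      = of_int (a * a') + of_int (b * b') * (\<omega> * \<omega>) + of_int (a * b' + b * a') * \<omega>"
    by (simp add: algebra_simps)
  then show ?thesis by (simp add: omega_square mult_ac)
qed

lemma d_odd: "odd d"
  using d_mod_4 by presburger

lemma order_closed:
  assumes "x \<in> \<O>" "y \<in> \<O>"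
  shows "x + y \<in> \<O>" "- x \<in> \<O>" "x * y \<in> \<O>"
proof -
  obtain a b a' b' where xy: "x = of_int a + of_int b * \<omega>" "y = of_int a' + of_int b' * \<omega>"
    using assms by (auto simp: \<O>_def)
  have "x + y = of_int (a + a') + of_int (b + b') * \<omega>" "- x = of_int (- a) + of_int (- b) * \<omega>"
    by (simp_all add: xy algebra_simps)
  with mult_expand[of a b a' b'] show "x + y \<in> \<O>" "- x \<in> \<O>" "x * y \<in> \<O>"
    unfolding \<O>_def xy by blast+
qed

lemma of_int_in_order [simp]: "of_int n \<in> \<O>"
  unfolding \<O>_def by (auto intro: exI[of _ n] exI[of _ 0])

lemma one_in_order [simp]: "1 \<in> \<O>" and zero_in_order [simp]: "0 \<in> \<O>"
  using of_int_in_order[of 1] of_int_in_order[of 0] by simp_all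

lemma cnj_in_order: "x \<in> \<O> \<Longrightarrow> cnj x \<in> \<O>"
proof -
  assume "x \<in> \<O>"
  then obtain a b where x: "x = of_int a + of_int b * \<omega>" by (auto simp: \<O>_def)
  have "cnj x = of_int a + of_int (- b) * \<omega>" by (simp add: x cnj_omega)
  then show ?thesis unfolding \<O>_def by blast
qed

lemma m_subset_order: "\<m> \<subseteq> \<O>"
  by (auto simp: \<m>_def \<O>_def)

lemma in_m_iff: "of_int a + of_int b * \<omega> \<in> \<m> \<longleftrightarrow> even (a + b)"
  by (auto simp: \<m>_def int_plus_int_omega_eq_iff)

lemma m_closed:
  assumes "x \<in> \<m>"
  shows "y \<in> \<m> \<Longrightarrow> x + y \<in> \<m>" "- x \<in> \<m>" "y \<in> \<O> \<Longrightarrow> x * y \<in> \<m>"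
proof -
  obtain a b where x: "x = of_int a + of_int b * \<omega>" "even (a + b)"
    using assms by (auto simp: \<m>_def)
  have "- x = of_int (- a) + of_int (- b) * \<omega>" by (simp add: x)
  then show "- x \<in> \<m>" using x by (simp only: in_m_iff) simp
  show "x + y \<in> \<m>" if "y \<in> \<m>"
  proof -
    from that obtain a' b' where y: "y = of_int a' + of_int b' * \<omega>" "even (a' + b')"
      unfolding \<m>_def by blast
    have "x + y = of_int (a + a') + of_int (b + b') * \<omega>" by (simp add: x y algebra_simps)
    then show ?thesis using x y by (simp only: in_m_iff) simp
  qed
  show "x * y \<in> \<m>" if "y \<in> \<O>"
  proof -
    from that obtain a' b' where y: "y = of_int a' + of_int b' * \<omega>" by (auto simp: \<O>_def)
    have "even (a * a' + d * (b * b') + (a * b' + b * a'))" using x(2) d_odd by auto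
    then show ?thesis unfolding x y mult_expand in_m_iff .
  qed
qed

text \<open>The square of \<open>\<m>\<close> is \<open>2 \<m>\<close> because \<open>\<m> = 2 \<O>\<^sub>K\<close>.\<close>

lemma m_mult_m:
  assumes "x \<in> \<m>" "y \<in> \<m>"
  shows "\<exists>z\<in>\<m>. x * y = 2 * z"
proof -
  obtain a b a' b' where xy: "x = of_int a + of_int b * \<omega>" "y = of_int a' + of_int b' * \<omega>"
    and even: "even (a + b)" "even (a' + b')"
    using assms unfolding \<m>_def by blast
  obtain k k' l where "a + b = 2 * k" "a' + b' = 2 * k'" "d - 1 = 4 * l"
    using even d_mod_4 unfolding dvd_def by blast
  then have k: "a = 2 * k - b" "a' = 2 * k' - b'" "d = 4 * l + 1" by simp_all
  define p where "p = 2 * k * k' - k * b' - k' * b + b * b' + 2 * l * b * b'"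
  define q where "q = k * b' + k' * b - b * b'"
  have "a * a' + d * (b * b') = 2 * p" "a * b' + b * a' = 2 * q"
    by (simp_all add: k p_def q_def algebra_simps)
  then have "x * y = 2 * (of_int p + of_int q * \<omega>)"
    unfolding xy mult_expand by (simp add: algebra_simps)
  moreover have "even (p + q)" by (simp add: p_def q_def)
  ultimately show ?thesis using in_m_iff by blast
qed

lemma order_subset_maximal: "\<O> \<subseteq> \<O>\<^sub>K"
proof
  fix x assume "x \<in> \<O>"
  then obtain a b where x: "x = of_int a + of_int b * \<omega>" by (auto simp: \<O>_def)
  have "2 * x = of_int (2 * a) + of_int (2 * b) * \<omega>" by (simp add: x algebra_simps)
  then show "x \<in> \<O>\<^sub>K" unfolding \<O>\<^sub>K_def by (simp only: mem_Collect_eq in_m_iff) simp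
qed

lemma m_mult_maximal:
  assumes "x \<in> \<m>" "y \<in> \<O>\<^sub>K"
  shows "x * y \<in> \<m>"
proof -
  obtain z where "z \<in> \<m>" "x * (2 * y) = 2 * z"
    using m_mult_m assms unfolding \<O>\<^sub>K_def by blast
  then show ?thesis by simp
qed

lemma maximal_closed:
  assumes "x \<in> \<O>\<^sub>K" "y \<in> \<O>\<^sub>K"
  shows "x * y \<in> \<O>\<^sub>K"
  using m_mult_maximal[of "2 * x" y] assms by (simp add: \<O>\<^sub>K_def mult.assoc)

lemma cmod_square_nat:
  assumes "x \<in> \<O>"
  shows "\<exists>n. (cmod x)\<^sup>2 = of_nat n"
proof -
  obtain a b where x: "x = of_int a + of_int b * \<omega>" using assms by (auto simp: \<O>_def)
  have "(cmod x)\<^sup>2 = of_int (a\<^sup>2 - d * b\<^sup>2)"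
    using cmod_omega_square[of "of_int a" "of_int b"] by (simp add: x)
  moreover have "d * b\<^sup>2 \<le> 0" using d_neg by (intro mult_nonpos_nonneg) auto
  then have "0 \<le> a\<^sup>2 - d * b\<^sup>2" using zero_le_power2[of a] by (metis diff_ge_0_iff_ge order_trans)
  ultimately show ?thesis by (intro exI[of _ "nat (a\<^sup>2 - d * b\<^sup>2)"]) simp
qed

lemma cnj_mult_self:
  assumes "x = of_int a + of_int b * \<omega>"
  shows "cnj x * x = of_int (a * a - d * (b * b))"
proof -
  have "cnj x = of_int a + of_int (- b) * \<omega>" by (simp add: assms cnj_omega)
  then show ?thesis unfolding assms by (simp only: mult_expand) (simp add: algebra_simps)
qed

lemma norm_odd:
  assumes "u \<in> \<O>" "u \<notin> \<m>"
  shows "\<exists>n. cnj u * u = of_int (2 * n + 1)"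
proof -
  obtain a b where u: "u = of_int a + of_int b * \<omega>" using assms by (auto simp: \<O>_def)
  have "odd (a + b)" using assms(2) in_m_iff u by blast
  then have "odd (a * a - d * (b * b))" using d_odd by auto
  then obtain n where n: "a * a - d * (b * b) = 2 * n + 1" by (elim oddE)
  then show ?thesis using cnj_mult_self[OF u] by metis
qed

lemma euclidean_approximation: "\<exists>q\<in>\<O>\<^sub>K. cmod (z - q) < 1"
proof -
  define r where "r = sqrt (of_int (- d))"
  define s t where "s = Re z" and "t = Im z / r"
  have r: "r \<noteq> 0" using d_neg by (simp add: r_def)
  have z: "z = of_real s + of_real t * \<omega>"
    using r unfolding complex_eq_iff omega_eq r_def[symmetric] by (simp add: s_def t_def)
  define b where "b = round (2 * t)"
  define a where "a = b + 2 * round ((2 * s - of_int b) / 2)"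
  define q where "q = of_real (of_int a / 2) + of_real (of_int b / 2) * \<omega>"
  have "2 * q = of_int a + of_int b * \<omega>" by (simp add: q_def algebra_simps)
  then have "q \<in> \<O>\<^sub>K"
    unfolding \<O>\<^sub>K_def by (simp only: mem_Collect_eq in_m_iff) (simp add: a_def)
  have "\<bar>s - of_int a / 2\<bar> \<le> 1 / 2"
    using of_int_round_abs_le[of "(2 * s - of_int b) / 2"] by (simp add: a_def) argo
  then have s: "(s - of_int a / 2)\<^sup>2 \<le> 1 / 4"
    using power2_le_iff_abs_le[of "1 / 2" "s - of_int a / 2"] by (simp add: power2_eq_square)
  have "\<bar>t - of_int b / 2\<bar> \<le> 1 / 4"
    using of_int_round_abs_le[of "2 * t"] by (simp add: b_def) argo
  then have "(t - of_int b / 2)\<^sup>2 \<le> 1 / 16"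
    using power2_le_iff_abs_le[of "1 / 4" "t - of_int b / 2"] by (simp add: power2_eq_square)
  then have t: "of_int (- d) * (t - of_int b / 2)\<^sup>2 \<le> 11 * (1 / 16)"
    using d_bound d_neg by (intro mult_mono) auto
  have "z - q = of_real (s - of_int a / 2) + of_real (t - of_int b / 2) * \<omega>"
    by (simp add: z q_def algebra_simps)
  then have "(cmod (z - q))\<^sup>2 = (s - of_int a / 2)\<^sup>2 - of_int d * (t - of_int b / 2)\<^sup>2"
    by (simp only: cmod_omega_square)
  then have "(cmod (z - q))\<^sup>2 < 1\<^sup>2" using s t by simp
  then have "cmod (z - q) < 1" by (rule power_less_imp_less_base) simp
  then show ?thesis using \<open>q \<in> \<O>\<^sub>K\<close> by blast
qed

lemma odd_cancel:
  assumes "0 \<in> I" and add: "\<And>x y. x \<in> I \<Longrightarrow> y \<in> I \<Longrightarrow> x + y \<in> I"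
    and mult: "\<And>x y. x \<in> I \<Longrightarrow> y \<in> \<O> \<Longrightarrow> x * y \<in> I"
    and u: "u \<in> \<O>" "u \<notin> \<m>" and "u * x \<in> I" "2 * x \<in> I"
  shows "x \<in> I"
proof -
  obtain n where n: "cnj u * u = of_int (2 * n + 1)" using norm_odd[OF u] by blast
  have "u * x * cnj u \<in> I" using u assms cnj_in_order by blast
  moreover have "2 * x * of_int (- n) \<in> I" using assms of_int_in_order by blast
  ultimately have "u * x * cnj u + 2 * x * of_int (- n) \<in> I" by (rule add)
  moreover have "u * x * cnj u = (cnj u * u) * x" by (simp add: mult_ac)
  then have "u * x * cnj u + 2 * x * of_int (- n) = x"
    unfolding n by (simp add: algebra_simps)
  ultimately show ?thesis by simp
qed

text \<open>The intersection \<open>I \<inter> \<m>\<close> is an ideal of the Euclidean ring \<open>\<O>\<^sub>K\<close>, generated by \<open>g\<close> say;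
  then \<open>g / 2\<close> generates \<open>I\<close> up to a unit of \<open>\<O>\<^sub>K\<close>.\<close>

lemma odd_ideal_principal:
  assumes I: "I \<subseteq> \<O>" "0 \<in> I" and add: "\<And>x y. x \<in> I \<Longrightarrow> y \<in> I \<Longrightarrow> x + y \<in> I"
    and mult: "\<And>x y. x \<in> I \<Longrightarrow> y \<in> \<O> \<Longrightarrow> x * y \<in> I"
    and u: "u \<in> I" "u \<notin> \<m>"
    and unit: "\<And>h t. h \<in> \<O>\<^sub>K \<Longrightarrow> t \<in> \<O>\<^sub>K \<Longrightarrow> t * h \<in> \<O> - \<m> \<Longrightarrow>
      \<exists>\<epsilon>\<in>\<O>\<^sub>K. \<exists>\<epsilon>'\<in>\<O>\<^sub>K. \<epsilon> * \<epsilon>' = 1 \<and> \<epsilon> * h \<in> \<O>"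
  shows "\<exists>c\<in>I. \<forall>x\<in>I. \<exists>r\<in>\<O>. x = r * c"
proof -
  have u\<O>: "u \<in> \<O>" using u I by blast
  have cancel: "x \<in> I" if "u * x \<in> I" "2 * x \<in> I" for x
    using I(2) add mult u\<O> u(2) that by (rule odd_cancel)
  have two_m: "2 * x \<in> \<m>" if "x \<in> \<O>" for x
    using that order_subset_maximal by (auto simp: \<O>\<^sub>K_def)
  have two_I: "2 * x \<in> I" if "x \<in> I" for x using add[OF that that] unfolding mult_2 .
  have J_mult: "x * y \<in> I \<inter> \<m>" if x: "x \<in> I \<inter> \<m>" and y: "y \<in> \<O>\<^sub>K" for x y
  proof -
    have xy: "x * y \<in> \<m>" using x by (intro m_mult_maximal y) simp
    have "u * (x * y) \<in> I" using xy m_subset_order by (intro mult u) blast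
    moreover have "x * (2 * y) \<in> I" using x y m_subset_order by (intro mult) (auto simp: \<O>\<^sub>K_def)
    then have "2 * (x * y) \<in> I" by (simp add: mult.left_commute)
    ultimately have "x * y \<in> I" by (rule cancel)
    with xy show ?thesis by simp
  qed
  have "u \<noteq> 0" using u(2) in_m_iff[of 0 0] by auto
  then have "2 * u \<in> I \<inter> \<m> - {0}" using two_I[OF u(1)] two_m[OF u\<O>] by simp
  then obtain g where g: "g \<in> I \<inter> \<m> - {0}"
    and "\<forall>x. x \<in> I \<inter> \<m> - {0} \<longrightarrow> nat \<lfloor>(cmod g)\<^sup>2\<rfloor> \<le> nat \<lfloor>(cmod x)\<^sup>2\<rfloor>"
    using ex_has_least_nat[of "\<lambda>x. x \<in> I \<inter> \<m> - {0}" "2 * u" "\<lambda>x. nat \<lfloor>(cmod x)\<^sup>2\<rfloor>"] by blast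
  moreover have "(cmod g)\<^sup>2 \<le> (cmod x)\<^sup>2"
    if "nat \<lfloor>(cmod g)\<^sup>2\<rfloor> \<le> nat \<lfloor>(cmod x)\<^sup>2\<rfloor>" "x \<in> \<O>" "g \<in> \<O>" for x
  proof -
    from cmod_square_nat[OF that(2)] cmod_square_nat[OF that(3)]
    obtain n k where "(cmod g)\<^sup>2 = of_nat n" "(cmod x)\<^sup>2 = of_nat k" by blast
    with that(1) show ?thesis by simp
  qed
  ultimately have minimal: "(cmod g)\<^sup>2 \<le> (cmod x)\<^sup>2" if "x \<in> I \<inter> \<m> - {0}" for x
    using that I by blast
  have J_principal: "\<exists>q\<in>\<O>\<^sub>K. x = q * g" if x: "x \<in> I \<inter> \<m>" for x
  proof -
    obtain q where q: "q \<in> \<O>\<^sub>K" "cmod (x / g - q) < 1" using euclidean_approximation by blast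
    have gq: "g * q \<in> I \<inter> \<m>" using g by (intro J_mult q) simp
    have "g * q * of_int (- 1) \<in> I" using gq by (intro mult[OF _ of_int_in_order]) simp
    then have "x + g * q * of_int (- 1) \<in> I" using x by (intro add) simp
    moreover have "x + - (g * q) \<in> \<m>" using x gq by (intro m_closed(1,2)) simp_all
    ultimately have in_J: "x - g * q \<in> I \<inter> \<m>" by simp
    have "x - g * q = (x / g - q) * g" using g by (simp add: field_simps)
    then have "cmod (x - g * q) < cmod g"
      using q(2) g mult_strict_right_mono[of "cmod (x / g - q)" 1 "cmod g"] by (simp add: norm_mult)
    then have "(cmod (x - g * q))\<^sup>2 < (cmod g)\<^sup>2" by (intro power_strict_mono) auto
    then have "x - g * q = 0" using minimal[of "x - g * q"] in_J by (metis DiffI linorder_not_le singletonD)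
    then show ?thesis using q by (auto simp: mult.commute)
  qed
  define h where "h = g / 2"
  have g_eq: "g = 2 * h" by (simp add: h_def)
  have h: "h \<in> \<O>\<^sub>K" using g by (simp add: \<O>\<^sub>K_def g_eq)
  have halve: "\<exists>q\<in>\<O>\<^sub>K. x = q * h" if x: "x \<in> I" for x
  proof -
    have "2 * x \<in> I \<inter> \<m>" using x I two_I two_m by blast
    then show ?thesis using J_principal by (fastforce simp: g_eq)
  qed
  obtain t where t: "t \<in> \<O>\<^sub>K" "u = t * h" using halve u by blast
  then obtain \<epsilon> \<epsilon>' where \<epsilon>: "\<epsilon> \<in> \<O>\<^sub>K" "\<epsilon>' \<in> \<O>\<^sub>K" "\<epsilon> * \<epsilon>' = 1" "\<epsilon> * h \<in> \<O>"
    using unit[OF h t(1)] u u\<O> by blast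
  define c where "c = \<epsilon> * h"
  have "\<epsilon>' * c = (\<epsilon> * \<epsilon>') * h" by (simp add: c_def mult_ac)
  then have h_eq: "h = \<epsilon>' * c" using \<epsilon>(3) by simp
  have c\<O>: "c \<in> \<O>" using \<epsilon> by (simp add: c_def)
  have "u = c * (t * \<epsilon>')" by (simp add: t h_eq mult_ac)
  then have c_odd: "c \<notin> \<m>" using u m_mult_maximal maximal_closed t \<epsilon> by metis
  have "c \<in> I"
  proof (rule cancel)
    show "u * c \<in> I" using mult u c\<O> by blast
    show "2 * c \<in> I" using J_mult[of g \<epsilon>] g \<epsilon> by (auto simp: c_def g_eq mult_ac)
  qed
  moreover have "\<exists>r\<in>\<O>. x = r * c" if x: "x \<in> I" for x
  proof -
    obtain q where q: "q \<in> \<O>\<^sub>K" "x = q * h" using halve x by blast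
    then have x_eq: "x = c * (q * \<epsilon>')" by (simp add: h_eq mult_ac)
    have "q * \<epsilon>' \<in> \<O>"
    proof (rule odd_cancel[where I = \<O> and u = c])
      show "c * (q * \<epsilon>') \<in> \<O>" using x I x_eq by blast
      show "2 * (q * \<epsilon>') \<in> \<O>"
        using maximal_closed[OF q(1) \<epsilon>(2)] m_subset_order by (auto simp: \<O>\<^sub>K_def)
    qed (use order_closed c\<O> c_odd in simp_all)
    then show ?thesis using x_eq mult.commute by metis
  qed
  ultimately show ?thesis by blast
qed

end

lemma int_adjoin_simps:
  "x \<oplus>\<^bsub>\<int>[\<alpha>]\<^esub> y = x + y" "x \<otimes>\<^bsub>\<int>[\<alpha>]\<^esub> y = x * y" "\<one>\<^bsub>\<int>[\<alpha>]\<^esub> = 1" "\<zero>\<^bsub>\<int>[\<alpha>]\<^esub> = 0"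
  by (simp_all add: int_adjoin_def ring_of_type_algebra_def)

context imaginary_order
begin

lemma carrier_order: "carrier \<int>[\<omega>] = \<O>"
  unfolding \<omega>_def \<O>_def by (rule carrier_int_adjoin_csqrt)

lemma domain_order: "domain \<int>[\<omega>]"
proof (intro domain.intro domain_axioms.intro cringI abelian_groupI comm_monoidI)
  fix x assume "x \<in> carrier \<int>[\<omega>]"
  then show "\<exists>y\<in>carrier \<int>[\<omega>]. y \<oplus>\<^bsub>\<int>[\<omega>]\<^esub> x = \<zero>\<^bsub>\<int>[\<omega>]\<^esub>"
    using order_closed(2)[of x x] by (intro bexI[of _ "- x"]) (simp_all add: int_adjoin_simps carrier_order)
qed (auto simp: int_adjoin_simps carrier_order order_closed algebra_simps)

definition filtration :: "nat \<Rightarrow> complex set" where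
  "filtration k = (case k of 0 \<Rightarrow> \<O> | Suc j \<Rightarrow> (*) (2 ^ j) ` \<m>)"

lemma filtration_simps: "filtration 0 = \<O>" "filtration (Suc k) = (*) (2 ^ k) ` \<m>"
  by (simp_all add: filtration_def)

lemma order_idealI:
  assumes "I \<subseteq> \<O>" "0 \<in> I" "\<And>x y. x \<in> I \<Longrightarrow> y \<in> I \<Longrightarrow> x + y \<in> I"
    "\<And>x y. x \<in> I \<Longrightarrow> y \<in> \<O> \<Longrightarrow> x * y \<in> I"
  shows "ideal I \<int>[\<omega>]"
proof -
  interpret domain "\<int>[\<omega>]" by (rule domain_order)
  show ?thesis
  proof (rule idealI)
    show "subgroup I (add_monoid \<int>[\<omega>])"
    proof (rule add.subgroupI)
      fix x assume x: "x \<in> I"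
      have "x * of_int (- 1) \<in> I" using x by (intro assms of_int_in_order)
      moreover have "\<ominus>\<^bsub>\<int>[\<omega>]\<^esub> x = - x"
        using x assms(1) order_closed(2)[of x x]
        by (intro minus_equality) (auto simp: int_adjoin_simps carrier_order)
      ultimately show "\<ominus>\<^bsub>\<int>[\<omega>]\<^esub> x \<in> I" by simp
    qed (use assms in \<open>auto simp: int_adjoin_simps carrier_order\<close>)
  next
    fix x y assume "x \<in> I" "y \<in> carrier \<int>[\<omega>]"
    then show "x \<otimes>\<^bsub>\<int>[\<omega>]\<^esub> y \<in> I" "y \<otimes>\<^bsub>\<int>[\<omega>]\<^esub> x \<in> I"
      using assms(4)[of x y] by (simp_all add: int_adjoin_simps carrier_order mult.commute)
  qed (rule ring_axioms)
qed

lemma filtration_ideal: "ideal (filtration k) \<int>[\<omega>]"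
proof (cases k)
  case 0
  show ?thesis unfolding 0 filtration_simps by (rule order_idealI) (auto simp: order_closed)
next
  case (Suc j)
  show ?thesis unfolding Suc filtration_simps
  proof (rule order_idealI)
    have "2 ^ j \<in> \<O>" using of_int_in_order[of "2 ^ j"] by simp
    then show "(*) (2 ^ j) ` \<m> \<subseteq> \<O>" using m_subset_order order_closed(3) by blast
    show "0 \<in> (*) (2 ^ j) ` \<m>" using in_m_iff[of 0 0] by force
  next
    fix x y assume "x \<in> (*) (2 ^ j) ` \<m>" "y \<in> (*) (2 ^ j) ` \<m>"
    then show "x + y \<in> (*) (2 ^ j) ` \<m>" using m_closed(1) by (auto simp flip: distrib_left)
  next
    fix x y assume "x \<in> (*) (2 ^ j) ` \<m>" "y \<in> \<O>"
    then show "x * y \<in> (*) (2 ^ j) ` \<m>" using m_closed(3) by (auto simp: mult.assoc)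
  qed
qed

lemma int_zero_if_all_powers_dvd:
  assumes "\<And>k. (2::int) ^ k dvd a"
  shows "a = 0"
proof (rule ccontr)
  assume a: "a \<noteq> 0"
  have "2 ^ nat \<bar>a\<bar> \<le> \<bar>a\<bar>" using dvd_imp_le_int[OF a assms] by simp
  moreover have "int (nat \<bar>a\<bar>) < int (2 ^ nat \<bar>a\<bar>)" unfolding of_nat_less_iff by (rule less_exp)
  ultimately show False by simp
qed

lemma filtration_separated: "(\<Inter>k. filtration k) = {0}"
proof
  show "(\<Inter>k. filtration k) \<subseteq> {0}"
  proof
    fix x assume x: "x \<in> (\<Inter>k. filtration k)"
    then have "x \<in> filtration 0" by blast
    then obtain a b where ab: "x = of_int a + of_int b * \<omega>" by (auto simp: filtration_simps \<O>_def)
    have dvd: "2 ^ k dvd a \<and> 2 ^ k dvd b" for k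
    proof -
      have "x \<in> filtration (Suc k)" using x by blast
      then obtain a' b' where "x = 2 ^ k * (of_int a' + of_int b' * \<omega>)"
        by (auto simp: filtration_simps \<m>_def)
      then have "of_int a + of_int b * \<omega> = of_int (2 ^ k * a') + of_int (2 ^ k * b') * \<omega>"
        by (simp add: ab algebra_simps)
      then show ?thesis unfolding int_plus_int_omega_eq_iff by simp
    qed
    then show "x \<in> {0}" using int_zero_if_all_powers_dvd[of a] int_zero_if_all_powers_dvd[of b] ab by simp
  qed
  have "0 \<in> filtration k" for k
    using ideal.axioms(1)[OF filtration_ideal, THEN additive_subgroup.zero_closed, of k]
    by (simp add: int_adjoin_simps)
  then show "{0} \<subseteq> (\<Inter>k. filtration k)" by blast
qed

lemma principal_filtration_order:
  assumes unit: "\<And>h t. h \<in> \<O>\<^sub>K \<Longrightarrow> t \<in> \<O>\<^sub>K \<Longrightarrow> t * h \<in> \<O> - \<m> \<Longrightarrow>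
      \<exists>\<epsilon>\<in>\<O>\<^sub>K. \<exists>\<epsilon>'\<in>\<O>\<^sub>K. \<epsilon> * \<epsilon>' = 1 \<and> \<epsilon> * h \<in> \<O>"
  shows "principal_filtration \<int>[\<omega>] filtration"
proof (intro principal_filtration.intro principal_filtration_axioms.intro domain_order filtration_ideal)
  show "filtration 0 = carrier \<int>[\<omega>]" by (simp add: filtration_simps carrier_order)
  show "(\<Inter>k. filtration k) = {\<zero>\<^bsub>\<int>[\<omega>]\<^esub>}" by (simp add: filtration_separated int_adjoin_simps)
next
  fix x y k assume x: "x \<in> filtration k" and y: "y \<in> filtration 1"
  have ym: "y \<in> \<m>" using y by (simp add: filtration_def)
  have "x * y \<in> filtration (Suc k)"
  proof (cases k)
    case 0
    then show ?thesis using x ym m_closed(3)[of y x] by (simp add: filtration_def mult.commute)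
  next
    case (Suc j)
    then obtain x' where "x' \<in> \<m>" "x = 2 ^ j * x'" using x by (auto simp: filtration_simps)
    moreover obtain z where "z \<in> \<m>" "x' * y = 2 * z" using m_mult_m ym \<open>x' \<in> \<m>\<close> by blast
    ultimately have "x * y = 2 ^ k * z" "z \<in> \<m>" using Suc by (simp_all add: mult.assoc)
    then show ?thesis by (simp add: filtration_simps)
  qed
  then show "x \<otimes>\<^bsub>\<int>[\<omega>]\<^esub> y \<in> filtration (Suc k)" by (simp add: int_adjoin_simps)
next
  fix I assume I: "ideal I \<int>[\<omega>]" and "\<not> I \<subseteq> filtration 1"
  then obtain u where u: "u \<in> I" "u \<notin> \<m>" by (auto simp: filtration_def)
  interpret I: ideal I "\<int>[\<omega>]" by (rule I)
  have "\<exists>c\<in>I. \<forall>x\<in>I. \<exists>r\<in>\<O>. x = r * c"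
  proof (rule odd_ideal_principal)
    show "I \<subseteq> \<O>" using I.a_subset by (simp add: carrier_order)
    show "0 \<in> I" using additive_subgroup.zero_closed[OF I.additive_subgroup_axioms] by (simp add: int_adjoin_simps)
    show "x + y \<in> I" if "x \<in> I" "y \<in> I" for x y
      using additive_subgroup.a_closed[OF I.additive_subgroup_axioms that] by (simp add: int_adjoin_simps)
    show "x * y \<in> I" if "x \<in> I" "y \<in> \<O>" for x y
      using I.I_r_closed[of x y] that by (simp add: int_adjoin_simps carrier_order)
  qed (rule u unit, assumption?)+
  then obtain c where c: "c \<in> I" "\<And>x. x \<in> I \<Longrightarrow> \<exists>r\<in>\<O>. x = r * c" by blast
  have "r * c \<in> I" if "r \<in> \<O>" for r
    using I.I_l_closed[of c r] c that by (simp add: int_adjoin_simps carrier_order)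
  then have "I = PIdl\<^bsub>\<int>[\<omega>]\<^esub> c"
    using c(2) by (auto simp: cgenideal_def int_adjoin_simps carrier_order)
  then show "\<exists>c\<in>I. I = PIdl\<^bsub>\<int>[\<omega>]\<^esub> c" using c(1) by blast
qed

lemma maximal_cases:
  assumes "h \<in> \<O>\<^sub>K"
  obtains "h \<in> \<O>" | a b where "2 * h = of_int a + of_int b * \<omega>" "odd a" "odd b"
proof -
  obtain a b where ab: "2 * h = of_int a + of_int b * \<omega>" "even (a + b)"
    using assms unfolding \<O>\<^sub>K_def \<m>_def by blast
  show ?thesis
  proof (cases "even a")
    case True
    then obtain a' b' where "a = 2 * a'" "b = 2 * b'" using ab(2) by (auto elim!: evenE)
    then have "2 * h = 2 * (of_int a' + of_int b' * \<omega>)" using ab(1) by (simp add: algebra_simps)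
    then have "h = of_int a' + of_int b' * \<omega>" unfolding mult_cancel_left by simp
    then have "h \<in> \<O>" unfolding \<O>_def by blast
    then show ?thesis by (rule that)
  next
    case False
    then show ?thesis using ab that by simp
  qed
qed

end

lemma odd_square_mod_8: "odd (a::int) \<Longrightarrow> \<exists>k. a * a = 8 * k + 1"
proof (elim oddE)
  fix j assume "a = 2 * j + 1"
  moreover have "even (j * (j + 1))" by simp
  then obtain k where "j * (j + 1) = 2 * k" by (elim evenE)
  ultimately have "a * a = 8 * k + 1" by (simp add: algebra_simps)
  then show ?thesis ..
qed

lemma projective_free_csqrt_minus_3: "projective_free TYPE('m) \<int>[csqrt (of_int (- 3))]"
proof -
  interpret imaginary_order "- 3" by unfold_locales simp_all
  define u v where "u = (1 + \<omega>) / 2" and "v = (1 - \<omega>) / 2"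
  have "2 * u = of_int 1 + of_int 1 * \<omega>" "2 * v = of_int 1 + of_int (- 1) * \<omega>"
    by (simp_all add: u_def v_def)
  then have uv: "u \<in> \<O>\<^sub>K" "v \<in> \<O>\<^sub>K"
    unfolding \<O>\<^sub>K_def by (simp_all only: mem_Collect_eq in_m_iff) simp_all
  have "u * v = (1 - \<omega> * \<omega>) / 4" by (simp add: u_def v_def algebra_simps)
  then have uv1: "u * v = 1" "v * u = 1" by (simp_all add: omega_square mult.commute)
  have unit: "\<exists>\<epsilon>\<in>\<O>\<^sub>K. \<exists>\<epsilon>'\<in>\<O>\<^sub>K. \<epsilon> * \<epsilon>' = 1 \<and> \<epsilon> * h \<in> \<O>" if h: "h \<in> \<O>\<^sub>K" for h
    using h
  proof (cases rule: maximal_cases)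
    case 1
    have "1 \<in> \<O>\<^sub>K" using order_subset_maximal one_in_order by blast
    then show ?thesis using 1 by (intro bexI[of _ 1] conjI) simp_all
  next
    case (2 a b)
    have "4 dvd a + b \<or> 4 dvd a - b" using 2 by presburger
    then show ?thesis
    proof
      assume "4 dvd a + b"
      then obtain k where "a + b = 4 * k" by (elim dvdE)
      then have a: "a = 4 * k - b" by simp
      have "4 * (u * h) = (of_int 1 + of_int 1 * \<omega>) * (of_int a + of_int b * \<omega>)"
        unfolding 2(1)[symmetric] by (simp add: u_def)
      also have "\<dots> = 4 * (of_int (k - b) + of_int k * \<omega>)"
        unfolding mult_expand by (simp add: a algebra_simps)
      finally have "u * h = of_int (k - b) + of_int k * \<omega>" unfolding mult_cancel_left by simp
      then have "u * h \<in> \<O>" unfolding \<O>_def by blast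
      then show ?thesis using uv uv1 by blast
    next
      assume "4 dvd a - b"
      then obtain k where "a - b = 4 * k" by (elim dvdE)
      then have a: "a = 4 * k + b" by simp
      have "4 * (v * h) = (of_int 1 + of_int (- 1) * \<omega>) * (of_int a + of_int b * \<omega>)"
        unfolding 2(1)[symmetric] by (simp add: v_def)
      also have "\<dots> = 4 * (of_int (k + b) + of_int (- k) * \<omega>)"
        unfolding mult_expand by (simp add: a algebra_simps)
      finally have "v * h = of_int (k + b) + of_int (- k) * \<omega>" unfolding mult_cancel_left by simp
      then have "v * h \<in> \<O>" unfolding \<O>_def by blast
      then show ?thesis using uv uv1 by blast
    qed
  qed
  have "principal_filtration \<int>[\<omega>] filtration"
    by (rule principal_filtration_order) (rule unit)
  from principal_filtration.projective_free[OF this] show ?thesis unfolding \<omega>_def .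
qed

lemma projective_free_csqrt_minus_7: "projective_free TYPE('m) \<int>[csqrt (of_int (- 7))]"
proof -
  interpret imaginary_order "- 7" by unfold_locales simp_all
  have in_order: "h \<in> \<O>" if h: "h \<in> \<O>\<^sub>K" and t: "t \<in> \<O>\<^sub>K" and th: "t * h \<in> \<O> - \<m>" for h t
    using h
  proof (cases rule: maximal_cases)
    case (2 a b)
    obtain k l where "a * a = 8 * k + 1" "b * b = 8 * l + 1"
      using odd_square_mod_8[OF 2(2)] odd_square_mod_8[OF 2(3)] by blast
    then have ab: "cnj (2 * h) * (2 * h) = of_int (8 * (k + 7 * l + 1))"
      using cnj_mult_self[OF 2(1)] by simp
    obtain a' b' where t': "2 * t = of_int a' + of_int b' * \<omega>" "even (a' + b')"
      using t unfolding \<O>\<^sub>K_def \<m>_def by blast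
    from t'(2) obtain j where "a' + b' = 2 * j" by (elim evenE)
    then have a': "a' = 2 * j - b'" by simp
    have "a' * a' - (- 7) * (b' * b') = 4 * (j * j - j * b' + 2 * (b' * b'))"
      unfolding a' by (simp add: algebra_simps)
    then have "cnj (2 * t) * (2 * t) = of_int (4 * (j * j - j * b' + 2 * (b' * b')))"
      using cnj_mult_self[OF t'(1)] by metis
    moreover obtain n where n: "cnj (t * h) * (t * h) = of_int (2 * n + 1)"
      using norm_odd th by blast
    moreover have "cnj (2 * t) * (2 * t) * (cnj (2 * h) * (2 * h)) = 16 * (cnj (t * h) * (t * h))"
      by simp
    ultimately have "of_int (4 * (j * j - j * b' + 2 * (b' * b')) * (8 * (k + 7 * l + 1)))
        = (of_int (16 * (2 * n + 1)) :: complex)"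
      unfolding ab by simp
    then have "4 * (j * j - j * b' + 2 * (b' * b')) * (8 * (k + 7 * l + 1)) = 16 * (2 * n + 1)"
      unfolding of_int_eq_iff .
    moreover have "2 * (p * q) = m" if "4 * p * (8 * q) = 16 * m" for p q m :: int using that by simp
    ultimately have "2 * ((j * j - j * b' + 2 * (b' * b')) * (k + 7 * l + 1)) = 2 * n + 1" by blast
    then have False by presburger
    then show ?thesis ..
  qed
  have unit: "\<exists>\<epsilon>\<in>\<O>\<^sub>K. \<exists>\<epsilon>'\<in>\<O>\<^sub>K. \<epsilon> * \<epsilon>' = 1 \<and> \<epsilon> * h \<in> \<O>"
    if "h \<in> \<O>\<^sub>K" "t \<in> \<O>\<^sub>K" "t * h \<in> \<O> - \<m>" for h t
  proof -
    have "1 \<in> \<O>\<^sub>K" using order_subset_maximal one_in_order by blast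
    then show ?thesis using in_order[OF that] by (intro bexI[of _ 1] conjI) simp_all
  qed
  have "principal_filtration \<int>[\<omega>] filtration"
    by (rule principal_filtration_order) (rule unit)
  from principal_filtration.projective_free[OF this] show ?thesis unfolding \<omega>_def .
qed

theorem proposition4p8:
  shows "projective_free TYPE('m) \<int>[csqrt (-3)] \<and> projective_free TYPE('m) \<int>[csqrt (-7)]"
  using projective_free_csqrt_minus_3 projective_free_csqrt_minus_7 by simp

end
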